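(* Let $n\in\mathbb{N}$ and let $t$ be a real number with $|t|\leq 1$, $t\neq0$. Then $$ \begin{aligned} \sum_{k=1}^{\infty}\frac{t^k}{k\binom{n+k}{k}}={}&\frac{1}{1-t}\sum_{k=1}^n\left(H_k+H_{n-k}-H_n\right)\left(\frac{t-1}{t}\right)^{k}\\ &+\sum_{k=1}^n\frac{1}{k}\left(\frac{t-1}{t}\right)^{k-1}-\left(\frac{t-1}{t}\right)^n\log(1-t), \end{aligned} $$ where for $t=1$ the right-hand side is understood as its limit as $t\to1^-$.
   Context: $\mathbb{N}=\{1,2,3,\dots\}$. $H_m=\sum_{j=1}^m\frac1j$, with $H_0=0$. Infinite series are limits of partial sums. *)

theory Defs
  imports "HOL-Analysis.Analysis"
begin

definition series_term :: "nat \<Rightarrow> real \<Rightarrow> nat \<Rightarrow> real" where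
  "series_term n t k = t ^ k / (real k * real ((n + k) choose k))"

text \<open>
  The harmonic number \<open>H\<^sub>m\<close> is the library's \<^const>\<open>harm\<close>. For \<open>t = 1\<close> the closed form contains
  \<open>1 / 0\<close> and \<open>ln 0\<close>, so its value there is a junk value without mathematical meaning; only its
  values near \<open>1\<close> are used in that case, through the limit from the left.
\<close>

definition closed_form :: "nat \<Rightarrow> real \<Rightarrow> real" where
  "closed_form n t =
     1 / (1 - t) * (\<Sum>k=1..n. (harm k + harm (n - k) - harm n) * ((t - 1) / t) ^ k)
     + (\<Sum>k=1..n. 1 / real k * ((t - 1) / t) ^ (k - 1))
     - ((t - 1) / t) ^ n * ln (1 - t)"

end

theory Submission
  imports Defs "HOL-Real_Asymp.Real_Asymp"
begin

text \<open>
  The coefficient of \<open>t\<^sup>k\<close> in the series is the Beta value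
  \<open>B(k, n + 1) = \<integral>\<^sub>0\<^sup>1 x\<^sup>k\<^sup>-\<^sup>1 (1 - x)\<^sup>n dx\<close>. Multiplying the integrand by
  \<open>1 - x\<close> shows that raising \<open>n\<close> by one takes a difference in \<open>k\<close>. Hence, writing
  \<open>S\<^sub>n\<close> for the sum of the series and \<open>u = (t - 1) / t\<close>, the sums obey the first-order recurrence
  \<open>S\<^sub>n\<^sub>+\<^sub>1 = u S\<^sub>n + 1 / (n + 1)\<close> with \<open>S\<^sub>0 = - ln (1 - t)\<close>. Solving it gives
  \[ S_n = \sum_{k=1}^n \frac{u^{n-k}}{k} - u^n \ln (1 - t), \]
  which is lemma \<open>beta_series_sums\<close>. The recurrence only shifts and subtracts convergent series,
  so the conditionally convergent case \<open>t = -1\<close> needs care only for \<open>n = 0\<close>.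

  The stated closed form is the same expression in disguise (lemma \<open>closed_form_eq\<close>). Since
  \<open>1 / (1 - t) = - (1 - u) / u\<close>, their equality is a polynomial identity in \<open>u\<close>, and
  comparing coefficients reduces it to the increments of \<open>k \<mapsto> H\<^sub>k + H\<^sub>n\<^sub>-\<^sub>k - H\<^sub>n\<close>, a sequence that
  vanishes at both ends \<open>k = 0\<close> and \<open>k = n\<close> (lemma \<open>harm_reflect_polynomial\<close>).

  At \<open>t = 1\<close> the starting series \<open>S\<^sub>0\<close> diverges, but for \<open>n \<ge> 1\<close> the difference property makes
  the series telescope to \<open>1 / n\<close>. This is also the left limit of the closed form: there
  \<open>u\<close> tends to \<open>0\<close>, so only the summand \<open>k = n\<close> survives, and \<open>u\<^sup>n\<close> kills the logarithm.
\<close>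

definition beta_coeff :: "nat \<Rightarrow> nat \<Rightarrow> real" where
  "beta_coeff n k = 1 / (real k * real ((n + k) choose k))"

lemma series_term_eq: "series_term n t k = beta_coeff n k * t ^ k"
  by (simp add: series_term_def beta_coeff_def)

lemma beta_coeff_0: "beta_coeff 0 k = 1 / real k"
  by (simp add: beta_coeff_def)

lemma beta_coeff_1: "beta_coeff n (Suc 0) = 1 / real (Suc n)"
  by (simp add: beta_coeff_def)

text \<open>
  This is \<open>B(k, n + 2) = B(k, n + 1) - B(k + 1, n + 1)\<close>. The binomial coefficients of the first
  and the last term are rational multiples of the one in \<open>beta_coeff n (Suc k)\<close>, by the absorption identities, and after
  substituting them only a rational identity remains.
\<close>
lemma beta_coeff_Suc:
  "beta_coeff (Suc n) (Suc k) = beta_coeff n (Suc k) - beta_coeff n (Suc (Suc k))"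
proof -
  define B where "B = real ((n + Suc k) choose Suc k)"
  have B0: "B > 0"
    unfolding B_def of_nat_0_less_iff by (rule zero_less_binomial) simp
  have "Suc n * (Suc n + Suc k choose Suc k) = Suc (n + Suc k) * (n + Suc k choose Suc k)"
    using binomial_absorb_comp[of "Suc (n + Suc k)" "Suc k"] by simp
  hence "real (Suc n) * real (Suc n + Suc k choose Suc k) = real (Suc (n + Suc k)) * B"
    unfolding B_def by (metis of_nat_mult)
  hence b1: "real (Suc n + Suc k choose Suc k) = (real n + real k + 2) * B / (real n + 1)"
    by (simp add: field_simps)
  have "Suc (Suc k) * (n + Suc (Suc k) choose Suc (Suc k)) =
          Suc (n + Suc k) * (n + Suc k choose Suc k)"
    using Suc_times_binomial_eq[of "n + Suc k" "Suc k"] by (simp only: mult.commute add_Suc_right)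
  hence "real (Suc (Suc k)) * real (n + Suc (Suc k) choose Suc (Suc k)) =
           real (Suc (n + Suc k)) * B"
    unfolding B_def by (metis of_nat_mult)
  hence b2: "real (n + Suc (Suc k) choose Suc (Suc k)) = (real n + real k + 2) * B / (real k + 2)"
    by (simp add: field_simps)
  show ?thesis
    unfolding beta_coeff_def b1 b2 B_def[symmetric] using B0
    by (simp add: divide_simps) (simp add: algebra_simps)
qed

text \<open>
  The binomial coefficient is at least \<open>1\<close>, so the bound \<open>1 / (k + 1)\<close> works for every \<open>n\<close>,
  including \<open>n = 0\<close>; this makes the series at \<open>t = 1\<close> telescope.
\<close>
lemma beta_coeff_tendsto_0: "(\<lambda>k. beta_coeff n (Suc k)) \<longlonglongrightarrow> 0"
proof (rule tendsto_sandwich[where f = "\<lambda>_. 0"])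
  show "\<forall>\<^sub>F k in sequentially. beta_coeff n (Suc k) \<le> inverse (real (Suc k))"
  proof (intro always_eventually allI)
    fix k
    have "real ((n + Suc k) choose Suc k) \<ge> 1"
      using zero_less_binomial[of "Suc k" "n + Suc k"] by linarith
    thus "beta_coeff n (Suc k) \<le> inverse (real (Suc k))"
      by (simp add: beta_coeff_def inverse_eq_divide divide_simps)
  qed
qed (auto simp: beta_coeff_def intro!: LIMSEQ_inverse_real_of_nat simp del: of_nat_Suc)

text \<open>
  The start \<open>n = 0\<close> of the recurrence. The endpoint \<open>t = -1\<close> lies outside the open interval
  of the power series of the logarithm and is the alternating harmonic series.
\<close>
lemma log_series_sums:
  fixes t :: real
  assumes "-1 \<le> t" "t < 1"
  shows "(\<lambda>k. t ^ Suc k / real (Suc k)) sums (- ln (1 - t))"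
proof (cases "t = -1")
  case True
  show ?thesis
    using sums_minus[OF alternating_harmonic_series_sums] by (simp add: True)
next
  case False
  hence "(\<lambda>k. - ((t ^ k) / real k)) sums ln (1 - t)"
    using ln_series'[of "-t"] assms by simp
  hence "(\<lambda>k. t ^ k / real k) sums (- ln (1 - t))"
    using sums_minus by fastforce
  thus ?thesis
    using sums_Suc_iff[of "\<lambda>k. t ^ k / real k"] by simp
qed

text \<open>
  By \<open>beta_coeff_Suc\<close>, the series for \<open>n + 1\<close> is the series for \<open>n\<close> minus its own tail, the tail
  being divided by \<open>t\<close> to restore the exponent:
  \<open>S\<^sub>n\<^sub>+\<^sub>1 = S\<^sub>n - (S\<^sub>n - t / (n + 1)) / t = u S\<^sub>n + 1 / (n + 1)\<close>.
\<close>
lemma beta_series_sums: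
  fixes t :: real
  assumes "-1 \<le> t" "t < 1" "t \<noteq> 0"
  defines "u \<equiv> (t - 1) / t"
  shows "(\<lambda>k. beta_coeff n (Suc k) * t ^ Suc k) sums
           ((\<Sum>k=1..n. u ^ (n - k) / real k) - u ^ n * ln (1 - t))"
proof (induction n)
  case 0
  show ?case
    using log_series_sums[OF assms(1,2)] by (simp add: beta_coeff_0)
next
  case (Suc n)
  define S where "S = (\<Sum>k=1..n. u ^ (n - k) / real k) - u ^ n * ln (1 - t)"
  let ?f = "\<lambda>k. beta_coeff n (Suc k) * t ^ Suc k"
  have f: "?f sums S"
    using Suc.IH by (simp only: S_def)
  have "(\<lambda>k. ?f (Suc k)) sums (S - ?f 0)"
    using f sums_Suc_iff[of ?f "S - ?f 0"] by simp
  hence "(\<lambda>k. ?f k - ?f (Suc k) / t) sums (S - (S - ?f 0) / t)"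
    by (intro sums_diff f sums_divide)
  moreover have "?f k - ?f (Suc k) / t = beta_coeff (Suc n) (Suc k) * t ^ Suc k" for k
    using assms(3) by (simp add: beta_coeff_Suc field_simps)
  moreover have "S - (S - ?f 0) / t = u * S + 1 / real (Suc n)"
    using assms(3) by (simp add: beta_coeff_1 u_def divide_simps) (simp add: algebra_simps)
  moreover have "u * S + 1 / real (Suc n) =
      (\<Sum>k=1..Suc n. u ^ (Suc n - k) / real k) - u ^ Suc n * ln (1 - t)"
    by (simp add: S_def right_diff_distrib sum_distrib_left Suc_diff_le)
  ultimately show ?case by (simp only:)
qed

lemma beta_series_sums_at_1: "(\<lambda>k. beta_coeff (Suc n) (Suc k)) sums (1 / real (Suc n))"
  using telescope_sums'[OF beta_coeff_tendsto_0[of n]]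
  by (simp add: beta_coeff_Suc beta_coeff_1)

text \<open>
  With \<open>a\<^sub>k = H\<^sub>k + H\<^sub>n\<^sub>-\<^sub>k - H\<^sub>n\<close>, multiplying by \<open>1 - u\<close> turns the coefficients \<open>a\<^sub>k\<close> into the
  increments \<open>a\<^sub>k\<^sub>+\<^sub>1 - a\<^sub>k = 1 / (k + 1) - 1 / (n - k)\<close>; there are no boundary terms because
  \<open>a\<^sub>0 = a\<^sub>n = 0\<close>. Reading the second half of the increments backwards gives the reversed sum.
\<close>
lemma harm_reflect_polynomial:
  fixes u :: real
  shows "(1 - u) * (\<Sum>k=1..n. (harm k + harm (n - k) - harm n) * u ^ (k - 1)) =
           (\<Sum>k=1..n. u ^ (k - 1) / real k) - (\<Sum>k=1..n. u ^ (n - k) / real k)"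
proof -
  define a :: "nat \<Rightarrow> real" where "a k = harm k + harm (n - k) - harm n" for k
  have step: "a (Suc k) - a k = 1 / real (Suc k) - 1 / real (n - k)" if "k < n" for k
  proof -
    have "n - k = Suc (n - Suc k)" using that by simp
    hence "harm (n - k) = harm (n - Suc k) + inverse (of_nat (n - k) :: real)"
      by (metis harm_Suc)
    thus ?thesis by (simp add: a_def harm_Suc inverse_eq_divide)
  qed
  have shift: "(\<Sum>k=1..n. f k) = (\<Sum>k<n. f (Suc k))" for f :: "nat \<Rightarrow> real"
    by (simp add: sum.atLeast1_atMost_eq)
  have "(1 - u) * (\<Sum>k=1..n. a k * u ^ (k - 1)) = (\<Sum>k<n. (1 - u) * (a (Suc k) * u ^ k))"
    unfolding shift sum_distrib_left by simp
  \<comment> \<open>Summation by parts: the second sum telescopes.\<close>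
  also have "\<dots> = (\<Sum>k<n. (a (Suc k) - a k) * u ^ k)
                   - (\<Sum>k<n. a (Suc k) * u ^ Suc k - a k * u ^ k)"
    unfolding sum_subtractf[symmetric] by (intro sum.cong) (auto simp: algebra_simps)
  also have "(\<Sum>k<n. a (Suc k) * u ^ Suc k - a k * u ^ k) = 0"
    using sum_lessThan_telescope[of "\<lambda>k. a k * u ^ k" n] by (simp add: a_def harm_expand)
  also have "(\<Sum>k<n. (a (Suc k) - a k) * u ^ k) =
      (\<Sum>k<n. u ^ k / real (Suc k)) - (\<Sum>k<n. u ^ k / real (n - k))"
    unfolding sum_subtractf[symmetric]
    by (intro sum.cong) (auto simp: step left_diff_distrib simp del: of_nat_Suc)
  also have "(\<Sum>k<n. u ^ k / real (n - k)) = (\<Sum>k<n. u ^ (n - Suc k) / real (Suc k))"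
    by (subst sum.nat_diff_reindex[symmetric]) (auto intro!: sum.cong simp del: of_nat_Suc)
  finally show ?thesis
    unfolding shift by (simp add: a_def)
qed

lemma closed_form_eq:
  assumes "t \<noteq> 0" "t \<noteq> 1"
  shows "closed_form n t =
    (\<Sum>k=1..n. ((t - 1) / t) ^ (n - k) / real k) - ((t - 1) / t) ^ n * ln (1 - t)"
proof -
  define u where "u = (t - 1) / t"
  have u: "1 / (1 - t) * u = - (1 - u)"
    using assms by (simp add: u_def divide_simps)
  have "1 / (1 - t) * (\<Sum>k=1..n. (harm k + harm (n - k) - harm n) * u ^ k) =
        1 / (1 - t) * u * (\<Sum>k=1..n. (harm k + harm (n - k) - harm n) * u ^ (k - 1))"
    unfolding sum_distrib_left
    by (intro sum.cong) (auto simp: power_eq_if)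
  also have "\<dots> = (\<Sum>k=1..n. u ^ (n - k) / real k) - (\<Sum>k=1..n. u ^ (k - 1) / real k)"
    unfolding u mult_minus_left harm_reflect_polynomial by simp
  finally show ?thesis
    by (simp add: closed_form_def flip: u_def)
qed

text \<open>
  One factor \<open>u\<close> is kept with the logarithm, since \<open>u ln (1 - t)\<close> already tends to \<open>0\<close>; this is
  where a positive index is essential.
\<close>
lemma closed_form_tendsto_at_1:
  "(closed_form (Suc n) \<longlongrightarrow> 1 / real (Suc n)) (at_left 1)"
proof -
  let ?u = "\<lambda>t::real. (t - 1) / t"
  have u: "(?u \<longlongrightarrow> 0) (at_left 1)"
    by real_asymp
  have log: "((\<lambda>t. ?u t * ln (1 - t)) \<longlongrightarrow> 0) (at_left 1)"
    by real_asymp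
  have "((\<lambda>t. (\<Sum>k=1..Suc n. ?u t ^ (Suc n - k) / real k) - ?u t ^ n * (?u t * ln (1 - t)))
      \<longlongrightarrow> (\<Sum>k=1..Suc n. 0 ^ (Suc n - k) / real k) - 0 ^ n * 0) (at_left 1)"
    by (intro tendsto_intros u log) auto
  also have "(\<Sum>k=1..Suc n. 0 ^ (Suc n - k) / real k) = (1 / real (Suc n) :: real)"
    by (simp add: power_0_left)
  finally have *: "((\<lambda>t. (\<Sum>k=1..Suc n. ?u t ^ (Suc n - k) / real k) - ?u t ^ n * (?u t * ln (1 - t)))
      \<longlongrightarrow> 1 / real (Suc n)) (at_left 1)" by simp
  have "\<forall>\<^sub>F t in at_left (1::real). t \<in> {0<..<1}"
    by (rule eventually_at_left_real) simp
  hence "\<forall>\<^sub>F t in at_left 1. (\<Sum>k=1..Suc n. ?u t ^ (Suc n - k) / real k) 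
            - ?u t ^ n * (?u t * ln (1 - t)) = closed_form (Suc n) t"
    by eventually_elim (subst closed_form_eq; simp)
  with * show ?thesis
    by (rule Lim_transform_eventually)
qed

theorem theorem2p18:
  fixes n :: nat and t :: real
  assumes "n \<ge> 1" and "\<bar>t\<bar> \<le> 1" and "t \<noteq> 0"
  shows "(t \<noteq> 1 \<longrightarrow> (\<lambda>k. series_term n t (Suc k)) sums closed_form n t) \<and>
         (t = 1 \<longrightarrow> (\<exists>L. (closed_form n \<longlongrightarrow> L) (at_left 1) \<and>
                           (\<lambda>k. series_term n t (Suc k)) sums L))"
proof (intro conjI impI)
  assume "t \<noteq> 1"
  with assms show "(\<lambda>k. series_term n t (Suc k)) sums closed_form n t"
    using beta_series_sums[of t n] by (simp add: series_term_eq closed_form_eq)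
next
  assume "t = 1"
  obtain m where "n = Suc m"
    using assms(1) by (cases n) auto
  with \<open>t = 1\<close> show "\<exists>L. (closed_form n \<longlongrightarrow> L) (at_left 1) \<and>
                 (\<lambda>k. series_term n t (Suc k)) sums L"
    using closed_form_tendsto_at_1[of m] beta_series_sums_at_1[of m]
    by (auto simp: series_term_eq)
qed

end
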